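(* Let $\varrho$ be a primitive substitution on $\{{\tt a},{\tt b}\}$ with substitution matrix $M_\varrho$, having a one-sided fixed point ${\tt w}\in\mathcal{W}$, and let $k\in\mathbb{N}$, $\tau_k=\frac{k+\sqrt{k^2+4}}{2}$. (a) The following are equivalent: (i) $\lim_{n\to\infty}r(n)/n=k$; (ii) $[\tau_k\ 1]^T$ is a right Perron--Frobenius eigenvector of $M_\varrho$; (iii) there exist $m\in\mathbb{N}$, $n\in\mathbb{Z}_{\geqslant0}$ with $M_\varrho=\begin{bmatrix} km+n & m\\ m & n\end{bmatrix}$. (b) The following are equivalent: (i) $\lim_{n\to\infty}r(n)/n=-k$; (ii) $[1\ \tau_k]^T$ is a right Perron--Frobenius eigenvector of $M_\varrho$; (iii) there exist $m\in\mathbb{N}$, $n\in\mathbb{Z}_{\geqslant0}$ with $M_\varrho=\begin{bmatrix} n & m\\ m & km+n\end{bmatrix}$. (c) The following are equivalent: (i) $\lim_{n\to\infty}r(n)/n=0$; (ii) $[1\ 1]^T$ is a right Perron--Frobenius eigenvector of $M_\varrho$; (iii) $M_\varrho=\begin{bmatrix} a & b\\ c& d\end{bmatrix}$ with $a,b,c,d\in\mathbb{Z}_{\geqslant0}$ and $a+b=c+d$.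
   Context: $\mathcal{W}$ is the set of infinite one-sided words over $\{{\tt a},{\tt b}\}$ (indexed from $0$) in which both letters occur infinitely often. $p_{\tt a}(n)$, $p_{\tt b}(n)$ are the positions of the $n$-th ${\tt a}$ and $n$-th ${\tt b}$ in ${\tt w}$, and $r(n)=p_{\tt b}(n)-p_{\tt a}(n)$. The substitution matrix $M_\varrho$ has entries $(M_\varrho)_{\alpha\beta}=$ number of occurrences of letter $\alpha$ in $\varrho(\beta)$, with rows/columns ordered ${\tt a},{\tt b}$. *)

theory Defs
  imports
    "Jordan_Normal_Form.Spectral_Radius"
    "HOL-Library.Stream"
    "HOL-Library.Infinite_Set"
begin

datatype letter = LA | LB

definition words_W :: "letter stream set" where
  "words_W = {w. infinite {i. snth w i = LA} \<and> infinite {i. snth w i = LB}}"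

definition substitution :: "(letter \<Rightarrow> letter list) \<Rightarrow> bool" where
  "substitution \<rho> \<longleftrightarrow> (\<forall>\<alpha>. \<rho> \<alpha> \<noteq> [])"

definition subst_word :: "(letter \<Rightarrow> letter list) \<Rightarrow> letter list \<Rightarrow> letter list" where
  "subst_word \<rho> u = concat (map \<rho> u)"

text \<open>The constant \<^const>\<open>flat\<close> concatenates a stream of lists; it is meaningful here
  because the images of letters under a substitution are nonempty.\<close>

definition subst_stream :: "(letter \<Rightarrow> letter list) \<Rightarrow> letter stream \<Rightarrow> letter stream" where
  "subst_stream \<rho> w = flat (smap \<rho> w)"

definition primitive_substitution :: "(letter \<Rightarrow> letter list) \<Rightarrow> bool" where
  "primitive_substitution \<rho> \<longleftrightarrow>
     substitution \<rho> \<and> (\<exists>j\<ge>1. \<forall>\<alpha> \<beta>. \<alpha> \<in> set ((subst_word \<rho> ^^ j) [\<beta>]))"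

definition subst_matrix :: "(letter \<Rightarrow> letter list) \<Rightarrow> nat mat" where
  "subst_matrix \<rho> =
     mat_of_rows_list 2 (map (\<lambda>\<alpha>. map (\<lambda>\<beta>. count_list (\<rho> \<beta>) \<alpha>) [LA, LB]) [LA, LB])"

text \<open>The position of the \<open>n\<close>-th occurrence of a letter, where occurrences are counted from
  \<open>n = 1\<close> and positions from \<open>0\<close>; the value at \<open>n = 0\<close> is irrelevant.\<close>

definition letter_pos :: "letter \<Rightarrow> letter stream \<Rightarrow> nat \<Rightarrow> nat" where
  "letter_pos \<alpha> w n = enumerate {i. snth w i = \<alpha>} (n - 1)"

definition pos_diff :: "letter stream \<Rightarrow> nat \<Rightarrow> int" where
  "pos_diff w n = int (letter_pos LB w n) - int (letter_pos LA w n)"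

text \<open>The Perron--Frobenius eigenvalue of a primitive nonnegative matrix is its spectral radius
  (taken over the complex numbers), and its Perron--Frobenius eigenvectors are the strictly
  positive eigenvectors for that eigenvalue.\<close>

definition right_PF_eigenvector :: "real mat \<Rightarrow> real vec \<Rightarrow> bool" where
  "right_PF_eigenvector M v \<longleftrightarrow>
     eigenvector M v (spectral_radius (map_mat complex_of_real M)) \<and> (\<forall>i<dim_vec v. v $ i > 0)"

definition metallic_mean :: "nat \<Rightarrow> real" where
  "metallic_mean k = (real k + sqrt ((real k)\<^sup>2 + 4)) / 2"

end

theory Submission imports Defs "HOL-Real_Asymp.Real_Asymp" begin

text \<open>
  Let \<open>x\<close> be the slope of the right Perron--Frobenius eigenvector of the substitution matrix.
  A prefix \<open>u\<close> of the fixed point decomposes as \<open>u = \<rho>(u') v\<close> with \<open>u'\<close> a prefix and \<open>v\<close> of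
  bounded length. The functional \<open>|u|\<^sub>a - x |u|\<^sub>b\<close> is a left eigenvector for the second eigenvalue,
  while a positive left eigenvector of the dominant eigenvalue measures length; since the second
  eigenvalue is strictly smaller in modulus, the ratio of the two functionals contracts under
  desubstitution and tends to \<open>0\<close>. Hence both letters have frequencies, in the ratio \<open>x : 1\<close>, and
  \<open>r(n)/n\<close> tends to \<open>x - 1/x\<close>. This is injective in \<open>x > 0\<close> and equals \<open>k\<close> exactly at the metallic mean,
  whose irrationality forces the shape of the integer matrix.
\<close>

section \<open>Occurrences in streams\<close>

lemma count_list_stake_eq_card:
  "count_list (stake N w) \<alpha> = card {i. i < N \<and> w !! i = \<alpha>}"
proof (induction N)
  case 0
  then show ?case by simp
next
  case (Suc N)
  have "{i. i < Suc N \<and> w !! i = \<alpha>} =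
      (if w !! N = \<alpha> then insert N {i. i < N \<and> w !! i = \<alpha>} else {i. i < N \<and> w !! i = \<alpha>})"
    by (auto simp: less_Suc_eq)
  then show ?case
    using Suc by (simp add: stake_Suc del: stake.simps)
qed

lemma card_le_enumerate:
  fixes S :: "nat set"
  assumes "infinite S"
  shows "card {i. i < Suc (enumerate S n) \<and> i \<in> S} = Suc n"
proof -
  have "{i. i < Suc (enumerate S n) \<and> i \<in> S} = enumerate S ` {..n}"
    using assms enumerate_Ex[OF assms] enumerate_in_set[OF assms]
    by (force simp: less_Suc_eq_le)
  moreover have "inj_on (enumerate S) {..n}"
    using inj_enumerate[OF assms] by (rule inj_on_subset) simp
  ultimately show ?thesis
    by (simp add: card_image)
qed

text \<open>The prefix ending with the n-th occurrence contains exactly n copies of the letter, so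
  along these prefixes the frequency is n divided by the position plus one. Inverting this quotient
  gives the growth of the positions.\<close>

lemma letter_pos_asymptotics:
  assumes inf: "infinite {i. w !! i = \<alpha>}"
    and freq: "(\<lambda>N. real (count_list (stake N w) \<alpha>) / real N) \<longlonglongrightarrow> f"
    and "f > 0"
  shows "(\<lambda>n. real (letter_pos \<alpha> w n) / real n) \<longlonglongrightarrow> 1 / f"
proof -
  define p where "p = enumerate {i. w !! i = \<alpha>}"
  have cnt: "count_list (stake (Suc (p n)) w) \<alpha> = Suc n" for n
    using card_le_enumerate[OF inf, of n] unfolding count_list_stake_eq_card p_def by simp
  have "n \<le> Suc (p n)" for n
    using le_enumerate[OF inf, of n] unfolding p_def by simp
  then have "filterlim (\<lambda>n. Suc (p n)) at_top sequentially"
    by (intro filterlim_at_top_mono[OF filterlim_ident]) simp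
  from filterlim_compose[OF freq this]
  have "(\<lambda>n. real (Suc n) / real (Suc (p n))) \<longlonglongrightarrow> f"
    by (simp only: cnt)
  \<comment> \<open>The prefix is one longer than the position of its last letter; subtracting
    1/(n+1) removes that one. Working at \<open>Suc n\<close> matches the index shift in
    \<open>letter_pos\<close>.\<close>
  then have "(\<lambda>n. 1 / (real (Suc n) / real (Suc (p n))) - 1 / real (Suc n)) \<longlonglongrightarrow> 1 / f - 0"
    using \<open>f > 0\<close> LIMSEQ_Suc[OF lim_1_over_n[where 'a = real]]
    by (intro tendsto_intros) auto
  moreover have "1 / (real (Suc n) / real (Suc (p n))) - 1 / real (Suc n)
      = real (letter_pos \<alpha> w (Suc n)) / real (Suc n)" for n
    by (simp add: letter_pos_def p_def flip: diff_divide_distrib)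
  ultimately have "(\<lambda>n. real (letter_pos \<alpha> w (Suc n)) / real (Suc n)) \<longlonglongrightarrow> 1 / f"
    by simp
  then show ?thesis
    by (rule LIMSEQ_imp_Suc)
qed

section \<open>Substitutions\<close>

text \<open>Abelianisation: on the level of letter counts, applying \<open>\<rho>\<close> is
  multiplication by the substitution matrix.\<close>

lemma count_list_subst_word:
  "count_list (subst_word \<rho> u) \<alpha> =
     count_list (\<rho> LA) \<alpha> * count_list u LA + count_list (\<rho> LB) \<alpha> * count_list u LB"
proof (induction u)
  case Nil
  then show ?case by (simp add: subst_word_def)
next
  case (Cons \<beta> u)
  then show ?case by (cases \<beta>) (simp_all add: subst_word_def algebra_simps)
qed

lemma count_list_LA_plus_LB: "count_list u LA + count_list u LB = length u"
proof (induction u)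
  case (Cons \<beta> u)
  then show ?case by (cases \<beta>) auto
qed simp

text \<open>Nonempty images allow \<open>flat\<close> to be unfolded letter by letter, so a prefix
  of \<open>w\<close> can be substituted as a finite word.\<close>

lemma subst_stream_prefix:
  assumes "substitution \<rho>"
  shows "subst_stream \<rho> w = subst_word \<rho> (stake j w) @- subst_stream \<rho> (sdrop j w)"
proof (induction j arbitrary: w)
  case 0
  then show ?case by (simp add: subst_word_def)
next
  case (Suc j)
  have "\<rho> (shd w) \<noteq> []"
    using assms by (simp add: substitution_def)
  then have "subst_stream \<rho> w = \<rho> (shd w) @- subst_stream \<rho> (stl w)"
    unfolding subst_stream_def by (subst flat_unfold) auto
  also have "\<dots> = \<rho> (shd w) @- subst_word \<rho> (stake j (stl w)) @- subst_stream \<rho> (sdrop j (stl w))"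
    by (subst Suc) simp
  finally show ?case by (simp add: subst_word_def)
qed

lemma length_subst_word_ge:
  assumes "substitution \<rho>"
  shows "length u \<le> length (subst_word \<rho> u)"
proof (induction u)
  case (Cons \<beta> u)
  have "\<rho> \<beta> \<noteq> []"
    using assms by (simp add: substitution_def)
  then have "length (\<rho> \<beta>) \<ge> 1"
    by (simp add: Suc_le_eq)
  then show ?case
    using Cons by (simp add: subst_word_def)
qed simp

text \<open>Desubstitution: cut the prefix at the last boundary between letter images that it
  reaches. The rest is a proper prefix of a single image, and the sum of both image lengths bounds
  it whichever letter produced that image.\<close>

lemma fixed_point_prefix_decomposition:
  assumes sub: "substitution \<rho>" and fixp: "subst_stream \<rho> w = w"
  shows "\<exists>j v. stake N w = subst_word \<rho> (stake j w) @ v \<and>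
    length v \<le> length (\<rho> LA) + length (\<rho> LB)"
proof -
  define l where "l j = length (subst_word \<rho> (stake j w))" for j
  have "l (Suc N) \<ge> Suc N"
    using length_subst_word_ge[OF sub, of "stake (Suc N) w"] by (simp add: l_def)
  then have "N < l (Suc N)"
    by simp
  moreover have "\<not> N < l 0"
    by (simp add: l_def subst_word_def)
  \<comment> \<open>\<open>j\<close> is the number of letter images lying completely inside the
    first \<open>N\<close> letters.\<close>
  ultimately obtain j where j: "\<not> N < l j" "N < l (Suc j)"
    using ex_least_nat_less[of "\<lambda>j. N < l j" "Suc N"] by blast
  have "l (Suc j) = l j + length (\<rho> (w !! j))"
    by (simp add: l_def subst_word_def stake_Suc del: stake.simps)
  moreover have "length (\<rho> (w !! j)) \<le> length (\<rho> LA) + length (\<rho> LB)"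
    by (cases "w !! j") auto
  ultimately have short: "N - l j \<le> length (\<rho> LA) + length (\<rho> LB)"
    using j by simp
  have "w = subst_word \<rho> (stake j w) @- subst_stream \<rho> (sdrop j w)"
    using subst_stream_prefix[OF sub, of w j] fixp by simp
  then have "stake N w =
      take N (subst_word \<rho> (stake j w)) @ stake (N - l j) (subst_stream \<rho> (sdrop j w))"
    unfolding l_def by (metis stake_shift)
  then have "stake N w = subst_word \<rho> (stake j w) @ stake (N - l j) (subst_stream \<rho> (sdrop j w))"
    using j by (simp add: l_def)
  then show ?thesis
    using short by (metis length_stake)
qed

text \<open>If one of these counts vanished, some property of words that omit a letter would be
  preserved by \<open>\<rho>\<close> and hold for a one-letter word, so no iterate could contain
  both letters. The positive trace later separates the two eigenvalues in modulus.\<close>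

lemma primitive_substitution_counts:
  assumes "primitive_substitution \<rho>"
  shows "count_list (\<rho> LB) LA > 0" "count_list (\<rho> LA) LB > 0"
    "count_list (\<rho> LA) LA + count_list (\<rho> LB) LB > 0"
proof -
  obtain j where j: "\<And>\<alpha> \<beta>. \<alpha> \<in> set ((subst_word \<rho> ^^ j) [\<beta>])"
    using assms unfolding primitive_substitution_def by blast
  have inv: "P ((subst_word \<rho> ^^ i) u)" if "P u" "\<And>v. P v \<Longrightarrow> P (subst_word \<rho> v)" for P i u
    by (induction i) (auto intro: that)
  show "count_list (\<rho> LB) LA > 0"
  proof (rule ccontr)
    assume "\<not> ?thesis"
    then have "count_list ((subst_word \<rho> ^^ j) [LB]) LA = 0"
      by (intro inv[where P = "\<lambda>u. count_list u LA = 0"]) (auto simp: count_list_subst_word)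
    then show False
      using j[of LA LB] by (simp add: count_list_0_iff)
  qed
  show "count_list (\<rho> LA) LB > 0"
  proof (rule ccontr)
    assume "\<not> ?thesis"
    then have "count_list ((subst_word \<rho> ^^ j) [LA]) LB = 0"
      by (intro inv[where P = "\<lambda>u. count_list u LB = 0"]) (auto simp: count_list_subst_word)
    then show False
      using j[of LB LA] by (simp add: count_list_0_iff)
  qed
  show "count_list (\<rho> LA) LA + count_list (\<rho> LB) LB > 0"
  proof (rule ccontr)
    assume "\<not> ?thesis"
    \<comment> \<open>With zero diagonal the substitution exchanges the two letters, so the
      invariant has to allow either letter to be the missing one.\<close>
    then have "count_list ((subst_word \<rho> ^^ j) [LA]) LA = 0 \<or>
        count_list ((subst_word \<rho> ^^ j) [LA]) LB = 0"
      by (intro inv[where P = "\<lambda>u. count_list u LA = 0 \<or> count_list u LB = 0"])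
        (auto simp: count_list_subst_word)
    then show False
      using j[of LA LA] j[of LB LA] by (simp add: count_list_0_iff)
  qed
qed

section \<open>Letter frequencies\<close>

text \<open>As \<open>g\<close> tends to infinity, the recursion can be applied any fixed number of
  times once n is large. Each application gains a factor \<open>q\<close>, while the accumulated
  errors stay below a prescribed bound.\<close>

lemma contracting_recursion_tendsto_0:
  fixes e \<delta> :: "nat \<Rightarrow> real"
  assumes g: "filterlim g sequentially sequentially" and \<delta>: "\<delta> \<longlonglongrightarrow> 0"
    and rec: "eventually (\<lambda>n. e n \<le> q * e (g n) + \<delta> n) sequentially"
    and bnd: "\<And>n. e n \<le> B" and nonneg: "\<And>n. 0 \<le> e n" and q: "0 \<le> q" "q < 1"
  shows "e \<longlonglongrightarrow> 0"
proof -
  have iter: "eventually (\<lambda>n. e n \<le> q ^ j * B + \<epsilon>) sequentially" if "\<epsilon> > 0" for \<epsilon> j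
  proof (induction j)
    case 0
    show ?case
      using bnd that by (intro always_eventually) (simp add: add_increasing2)
  next
    case (Suc j)
    \<comment> \<open>This threshold makes the error term reproduce itself: q \<epsilon> + (1 - q)
      \<epsilon> = \<epsilon>.\<close>
    have "eventually (\<lambda>n. \<delta> n < (1 - q) * \<epsilon>) sequentially"
      using that q by (intro order_tendstoD(2)[OF \<delta>]) simp
    moreover have "eventually (\<lambda>n. e (g n) \<le> q ^ j * B + \<epsilon>) sequentially"
      using Suc g by (rule eventually_compose_filterlim)
    ultimately show ?case
      using rec
    proof eventually_elim
      case (elim n)
      have "q * e (g n) \<le> q * (q ^ j * B + \<epsilon>)"
        using elim q by (intro mult_left_mono) auto
      then show ?case
        using elim by (simp add: algebra_simps)
    qed
  qed
  show ?thesis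
  proof (rule order_tendstoI)
    fix a :: real
    assume "a < 0"
    then show "eventually (\<lambda>n. a < e n) sequentially"
      using nonneg by (intro always_eventually allI) (rule less_le_trans)
  next
    fix \<epsilon> :: real
    assume "0 < \<epsilon>"
    have "(\<lambda>j. q ^ j * B) \<longlonglongrightarrow> 0 * B"
      using q by (intro tendsto_intros LIMSEQ_realpow_zero)
    then have "eventually (\<lambda>j. q ^ j * B < \<epsilon> / 2) sequentially"
      using \<open>0 < \<epsilon>\<close> by (intro order_tendstoD(2)) auto
    then obtain j where j: "q ^ j * B < \<epsilon> / 2"
      by (auto simp: eventually_sequentially)
    have "eventually (\<lambda>n. e n \<le> q ^ j * B + \<epsilon> / 2) sequentially"
      using \<open>0 < \<epsilon>\<close> by (intro iter) simp
    then show "eventually (\<lambda>n. e n < \<epsilon>) sequentially"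
      by eventually_elim (use j in simp)
  qed
qed

text \<open>
  If \<open>x\<close> is the slope of the right Perron--Frobenius eigenvector, then \<open>(1, -x)\<close> and \<open>(c, b/x)\<close>
  are left eigenvectors, for the second eigenvalue \<open>a - c x\<close> and the dominant one \<open>c x + d\<close>.
\<close>

lemma fixed_point_letter_frequencies:
  fixes \<rho> w x
  defines "a \<equiv> real (count_list (\<rho> LA) LA)" and "b \<equiv> real (count_list (\<rho> LB) LA)"
    and "c \<equiv> real (count_list (\<rho> LA) LB)" and "d \<equiv> real (count_list (\<rho> LB) LB)"
  assumes prim: "primitive_substitution \<rho>" and fixp: "subst_stream \<rho> w = w"
    and x: "x > 0" and root: "c * x\<^sup>2 + (d - a) * x - b = 0"
  shows "(\<lambda>N. real (count_list (stake N w) LA) / real N) \<longlonglongrightarrow> x / (1 + x)"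
    and "(\<lambda>N. real (count_list (stake N w) LB) / real N) \<longlonglongrightarrow> 1 / (1 + x)"
proof -
  have pos: "b > 0" "c > 0" "a + d > 0" "a \<ge> 0" "d \<ge> 0"
    using primitive_substitution_counts[OF prim]
    by (simp_all add: a_def b_def c_def d_def flip: of_nat_add)
  have sub: "substitution \<rho>"
    using prim by (simp add: primitive_substitution_def)
  define A where "A N = real (count_list (stake N w) LA)" for N
  define B where "B N = real (count_list (stake N w) LB)" for N
  \<comment> \<open>\<open>D\<close> and \<open>L\<close> are the two left eigenvectors applied to
    the count vector of a prefix, with eigenvalues \<open>\<mu>\<close> and \<open>\<theta>\<close>.
    \<open>D\<close> measures the deviation from the ratio x : 1, and \<open>L\<close> lies between
    \<open>\<kappa>\<close> and \<open>K\<close> times the length.\<close>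
  define D where "D N = A N - x * B N" for N
  define L where "L N = c * A N + b / x * B N" for N
  define \<mu> where "\<mu> = a - c * x"
  define \<theta> where "\<theta> = c * x + d"
  define C where "C = real (length (\<rho> LA) + length (\<rho> LB))"
  define \<kappa> where "\<kappa> = min c (b / x)"
  define K where "K = c + b / x"
  define e where "e N = \<bar>D N\<bar> / L N" for N
  have \<theta>: "\<theta> > 0" and \<kappa>: "\<kappa> > 0"
    using pos x by (auto simp: \<theta>_def \<kappa>_def intro: add_pos_nonneg)
  have AB: "A N \<ge> 0" "B N \<ge> 0" "A N + B N = real N" for N
    using count_list_LA_plus_LB[of "stake N w"] by (simp_all add: A_def B_def flip: of_nat_add)
  have bx: "b / x = c * x + d - a"
    using root x by (simp add: field_simps power2_eq_square)
  \<comment> \<open>\<open>\<theta> + \<mu>\<close> is the trace \<open>a + d\<close>, and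
    \<open>\<theta> - \<mu>\<close> equals \<open>c * x + b / x\<close>; both are positive.\<close>
  have gap: "\<bar>\<mu>\<bar> < \<theta>"
  proof -
    have "b / x > 0" using pos x by simp
    moreover have "c * x > 0" using pos x by simp
    ultimately show ?thesis
      using pos bx unfolding \<mu>_def \<theta>_def by linarith
  qed
  have L_lower: "\<kappa> * real N \<le> L N" for N
    using mult_right_mono[of \<kappa> c "A N"] mult_right_mono[of \<kappa> "b / x" "B N"] AB[of N]
    by (simp add: L_def \<kappa>_def flip: AB(3)[of N]) (simp add: distrib_left)
  have L_upper: "L N \<le> K * real N" for N
    using AB[of N] pos x by (simp add: L_def K_def flip: AB(3)[of N]) (simp add: algebra_simps)
  have D_bound: "\<bar>D N\<bar> \<le> (1 + x) * real N" for N
  proof -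
    have "\<bar>D N\<bar> \<le> A N + x * B N"
      using AB[of N] x by (simp add: D_def abs_le_iff)
    also have "\<dots> \<le> (1 + x) * (A N + B N)"
      using AB(1,2)[of N] x by (simp add: distrib_left distrib_right)
    finally show ?thesis by (simp add: AB)
  qed
  obtain g v where dec: "\<And>N. stake N w = subst_word \<rho> (stake (g N) w) @ v N"
    and v: "\<And>N. real (length (v N)) \<le> C"
    using fixed_point_prefix_decomposition[OF sub fixp] unfolding C_def of_nat_le_iff by metis
  define va vb where "va N = real (count_list (v N) LA)" and "vb N = real (count_list (v N) LB)" for N
  have vab: "va N \<ge> 0" "vb N \<ge> 0" "va N + vb N \<le> C" for N
    using v[of N] count_list_LA_plus_LB[of "v N"]
    by (simp_all add: va_def vb_def flip: of_nat_add)
  have A_rec: "A N = a * A (g N) + b * B (g N) + va N" for N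
    unfolding A_def B_def a_def b_def va_def
    by (subst dec) (simp add: count_list_subst_word)
  have B_rec: "B N = c * A (g N) + d * B (g N) + vb N" for N
    unfolding A_def B_def c_def d_def vb_def
    by (subst dec) (simp add: count_list_subst_word)
  have b_eq: "b = x * (c * x + d - a)"
    using root by (simp add: algebra_simps power2_eq_square)
  \<comment> \<open>Eliminating \<open>b\<close> by the quadratic turns the matrix action into
    multiplication by the eigenvalue; only the bounded tail \<open>v N\<close> contributes an extra
    term.\<close>
  have D_rec: "D N = \<mu> * D (g N) + (va N - x * vb N)" for N
    unfolding D_def A_rec[of N] B_rec[of N] \<mu>_def b_eq by (simp add: algebra_simps)
  have L_rec: "L N = \<theta> * L (g N) + (c * va N + b / x * vb N)" for N
    unfolding L_def A_rec[of N] B_rec[of N] \<theta>_def bx unfolding b_eq by (simp add: algebra_simps)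
  have g_lim: "filterlim g sequentially sequentially"
  proof -
    \<comment> \<open>The prefix of length \<open>N\<close> is the image of \<open>g N\<close>
      letters and a tail of length at most \<open>C\<close>, so \<open>N\<close> is at most affine
      in \<open>g N\<close>, which must therefore be unbounded.\<close>
    have "real N \<le> (a + b + c + d + C) * real (g N + 1)" for N
    proof -
      have "real N = (a + c) * A (g N) + (b + d) * B (g N) + (va N + vb N)"
        unfolding AB(3)[of N, symmetric] A_rec[of N] B_rec[of N] by (simp add: algebra_simps)
      also have "\<dots> \<le> (a + b + c + d) * A (g N) + (a + b + c + d) * B (g N) + C"
        using vab[of N] AB[of "g N"] pos by (intro add_mono[OF add_mono] mult_right_mono) auto
      also have "\<dots> = (a + b + c + d) * real (g N) + C"
        by (simp flip: AB(3)[of "g N"] add: algebra_simps)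
      also have "\<dots> \<le> (a + b + c + d + C) * real (g N + 1)"
        using pos vab[of N] by (simp add: algebra_simps)
      finally show ?thesis .
    qed
    moreover have "a + b + c + d + C > 0"
      using pos by (simp add: C_def add_pos_nonneg)
    ultimately have ge: "real N / (a + b + c + d + C) - 1 \<le> real (g N)" for N
      by (simp add: field_simps)
    have "filterlim (\<lambda>N. real N / (a + b + c + d + C) - 1) at_top sequentially"
      using \<open>a + b + c + d + C > 0\<close> by real_asymp
    then have "filterlim (\<lambda>N. real (g N)) at_top sequentially"
      by (rule filterlim_at_top_mono) (use ge in simp)
    then have "eventually (\<lambda>N. real Z \<le> real (g N)) sequentially" for Z
      unfolding filterlim_at_top by blast
    then show ?thesis
      unfolding filterlim_at_top by simp
  qed
  have L_nonneg: "L N \<ge> 0" for N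
    by (rule order_trans[OF _ L_lower]) (use \<kappa> in simp)
  have L_pos: "L N > 0" if "N > 0" for N
    by (rule less_le_trans[OF _ L_lower]) (use \<kappa> that in simp)
  \<comment> \<open>The recursion for \<open>D\<close> is divided by \<open>L N\<close>, which is at
    least \<open>\<theta> * L (g N)\<close> and also at least \<open>\<kappa> * real N\<close>; the
    tail thus contributes only O(1/N).\<close>
  have e_rec: "e N \<le> \<bar>\<mu>\<bar> / \<theta> * e (g N) + (1 + x) * C / \<kappa> / real N" if "N > 0" for N
  proof -
    have LN: "L N > 0"
      using that by (rule L_pos)
    have "\<bar>va N - x * vb N\<bar> \<le> va N + x * vb N"
      using vab[of N] x by (simp add: abs_le_iff)
    also have "\<dots> \<le> (1 + x) * (va N + vb N)"
      using vab(1,2)[of N] x by (simp add: distrib_left distrib_right)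
    also have "\<dots> \<le> (1 + x) * C"
      using vab[of N] x by (intro mult_left_mono) auto
    finally have "\<bar>D N\<bar> \<le> \<bar>\<mu>\<bar> * \<bar>D (g N)\<bar> + (1 + x) * C"
      using abs_triangle_ineq[of "\<mu> * D (g N)" "va N - x * vb N"]
      unfolding D_rec[of N] abs_mult by linarith
    then have "e N \<le> \<bar>\<mu>\<bar> * \<bar>D (g N)\<bar> / L N + (1 + x) * C / L N"
      using LN by (simp add: e_def divide_right_mono flip: add_divide_distrib)
    also have "\<bar>\<mu>\<bar> * \<bar>D (g N)\<bar> / L N \<le> \<bar>\<mu>\<bar> / \<theta> * e (g N)"
    \<comment> \<open>\<open>L (g N)\<close> can vanish only for the empty prefix, where
      \<open>D\<close> vanishes too and both sides are 0.\<close>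
    proof (cases "L (g N) > 0")
      case True
      have "\<theta> * L (g N) \<le> L N"
        using L_rec[of N] vab[of N] pos x by simp
      then have "\<bar>\<mu>\<bar> * \<bar>D (g N)\<bar> / L N \<le> \<bar>\<mu>\<bar> * \<bar>D (g N)\<bar> / (\<theta> * L (g N))"
        using True \<theta> by (intro divide_left_mono) (auto simp: LN)
      then show ?thesis by (simp add: e_def)
    next
      case False
      then have "g N = 0"
        using L_pos[of "g N"] by blast
      then have "D (g N) = 0"
        using D_bound[of "g N"] by simp
      then show ?thesis by (simp add: e_def)
    qed
    also have "(1 + x) * C / L N \<le> (1 + x) * C / (\<kappa> * real N)"
      using L_lower[of N] \<kappa> that x LN by (intro divide_left_mono) (auto simp: C_def)
    finally show ?thesis by simp
  qed
  have "e \<longlonglongrightarrow> 0"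
  proof (rule contracting_recursion_tendsto_0[OF g_lim])
    show "(\<lambda>N. (1 + x) * C / \<kappa> / real N) \<longlonglongrightarrow> 0"
      by real_asymp
    show "eventually (\<lambda>N. e N \<le> \<bar>\<mu>\<bar> / \<theta> * e (g N) + (1 + x) * C / \<kappa> / real N) sequentially"
      using eventually_gt_at_top[of 0] by eventually_elim (rule e_rec)
    show "e N \<le> (1 + x) / \<kappa>" for N
    proof (cases "N = 0")
      case True
      then show ?thesis
        using D_bound[of 0] \<kappa> x by (simp add: e_def)
    next
      case False
      have "e N \<le> (1 + x) * real N / (\<kappa> * real N)"
        unfolding e_def using D_bound[of N] L_lower[of N] \<kappa> False x by (intro frac_le) auto
      then show ?thesis using False by simp
    qed
    show "0 \<le> e N" for N
      using L_nonneg by (simp add: e_def)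
    show "0 \<le> \<bar>\<mu>\<bar> / \<theta>" "\<bar>\<mu>\<bar> / \<theta> < 1"
      using \<theta> gap by auto
  qed
  \<comment> \<open>\<open>L\<close> grows at most linearly, so D/L tending to 0 carries over to
    D/N.\<close>
  moreover have "eventually (\<lambda>N. norm (D N / real N) \<le> norm (e N) * K) sequentially"
    using eventually_gt_at_top[of 0]
  proof eventually_elim
    case (elim N)
    have "L N > 0"
      using elim by (rule L_pos)
    then have "\<bar>D N\<bar> * L N \<le> \<bar>D N\<bar> * (K * real N)"
      using L_upper[of N] by (intro mult_left_mono) auto
    then show ?case
      using \<open>L N > 0\<close> elim by (simp add: e_def field_simps)
  qed
  ultimately have D_lim: "(\<lambda>N. D N / real N) \<longlonglongrightarrow> 0"
    by (rule tendsto_0_le)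
  \<comment> \<open>Solving A + B = N and A - x B = D gives (1 + x) A = x N + D and (1 + x) B = N -
    D; dividing by N yields both frequencies.\<close>
  have "(\<lambda>N. (x + D N / real N) / (1 + x)) \<longlonglongrightarrow> (x + 0) / (1 + x)"
    using x by (intro tendsto_intros D_lim) auto
  moreover have "eventually (\<lambda>N. (x + D N / real N) / (1 + x) = A N / real N) sequentially"
    using eventually_gt_at_top[of 0]
  proof eventually_elim
    case (elim N)
    have "x * real N + D N = (1 + x) * A N"
      unfolding D_def AB(3)[of N, symmetric] by (simp add: algebra_simps)
    then have "x + D N / real N = (1 + x) * (A N / real N)"
      using elim by (simp add: field_simps)
    then show ?case using x by simp
  qed
  ultimately show "(\<lambda>N. real (count_list (stake N w) LA) / real N) \<longlonglongrightarrow> x / (1 + x)"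
    unfolding A_def by (simp add: filterlim_cong)
  have "(\<lambda>N. (1 - D N / real N) / (1 + x)) \<longlonglongrightarrow> (1 - 0) / (1 + x)"
    using x by (intro tendsto_intros D_lim) auto
  moreover have "eventually (\<lambda>N. (1 - D N / real N) / (1 + x) = B N / real N) sequentially"
    using eventually_gt_at_top[of 0]
  proof eventually_elim
    case (elim N)
    have "real N - D N = (1 + x) * B N"
      unfolding D_def AB(3)[of N, symmetric] by (simp add: algebra_simps)
    then have "1 - D N / real N = (1 + x) * (B N / real N)"
      using elim by (simp add: field_simps)
    then show ?case using x by simp
  qed
  ultimately show "(\<lambda>N. real (count_list (stake N w) LB) / real N) \<longlonglongrightarrow> 1 / (1 + x)"
    unfolding B_def by (simp add: filterlim_cong)
qed

text \<open>By the letter frequencies, the positions of the n-th b and the n-th a grow like (1 + x)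
  n and (1 + 1/x) n.\<close>

lemma pos_diff_asymptotics:
  fixes \<rho> w x
  defines "a \<equiv> real (count_list (\<rho> LA) LA)" and "b \<equiv> real (count_list (\<rho> LB) LA)"
    and "c \<equiv> real (count_list (\<rho> LA) LB)" and "d \<equiv> real (count_list (\<rho> LB) LB)"
  assumes prim: "primitive_substitution \<rho>" and w: "w \<in> words_W" and fixp: "subst_stream \<rho> w = w"
    and x: "x > 0" and root: "c * x\<^sup>2 + (d - a) * x - b = 0"
  shows "(\<lambda>n. real_of_int (pos_diff w n) / real n) \<longlonglongrightarrow> x - 1 / x"
proof -
  note freq = fixed_point_letter_frequencies[OF prim fixp x root[unfolded a_def b_def c_def d_def]]
  have inf: "infinite {i. w !! i = LA}" "infinite {i. w !! i = LB}"
    using w by (auto simp: words_W_def)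
  have "(\<lambda>n. real (letter_pos LB w n) / real n - real (letter_pos LA w n) / real n)
      \<longlonglongrightarrow> 1 / (1 / (1 + x)) - 1 / (x / (1 + x))"
    using x by (intro tendsto_diff letter_pos_asymptotics inf freq) auto
  also have "1 / (1 / (1 + x)) - 1 / (x / (1 + x)) = x - 1 / x"
    using x by (simp add: field_simps)
  finally show ?thesis
    by (simp add: pos_diff_def diff_divide_distrib)
qed

section \<open>Two-by-two matrices\<close>

lemma mat_of_rows_list_2_eq_iff:
  "mat_of_rows_list 2 [[a, b], [c, d]] = mat_of_rows_list 2 [[a', b'], [c', d']] \<longleftrightarrow>
     a = a' \<and> b = b' \<and> c = c' \<and> d = d'"
  by (auto simp: mat_of_rows_list_def mat_eq_iff less_Suc_eq numeral_2_eq_2)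

lemma map_mat_of_rows_list_2:
  "map_mat f (mat_of_rows_list 2 [[a, b], [c, d]]) = mat_of_rows_list 2 [[f a, f b], [f c, f d]]"
  by (rule eq_matI) (auto simp: mat_of_rows_list_def less_Suc_eq numeral_2_eq_2)

lemma subst_matrix_eq:
  "subst_matrix \<rho> = mat_of_rows_list 2
     [[count_list (\<rho> LA) LA, count_list (\<rho> LB) LA], [count_list (\<rho> LA) LB, count_list (\<rho> LB) LB]]"
  by (simp add: subst_matrix_def)

lemma eigenvector_2_iff:
  fixes a b c d z s t :: "'a :: comm_ring_1"
  shows "eigenvector (mat_of_rows_list 2 [[a, b], [c, d]]) (vec_of_list [s, t]) z \<longleftrightarrow>
     (s \<noteq> 0 \<or> t \<noteq> 0) \<and> a * s + b * t = z * s \<and> c * s + d * t = z * t"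
proof -
  let ?M = "mat_of_rows_list 2 [[a, b], [c, d]]"
  have inj: "vec_of_list [p, q] = vec_of_list [p', q'] \<longleftrightarrow> p = p' \<and> q = q'" for p q p' q' :: 'a
    by (metis list.inject list_vec)
  have dim: "dim_row ?M = 2"
    by (simp add: mat_of_rows_list_def)
  have carrier: "vec_of_list [s, t] \<in> carrier_vec 2"
    by (rule carrier_vecI) (simp del: vec_of_list_Cons)
  have zero: "0\<^sub>v 2 = vec_of_list [0 :: 'a, 0]"
    by (rule eq_vecI) (auto simp: vec_of_list_index less_Suc_eq simp del: vec_of_list_Cons)
  have mult: "?M *\<^sub>v vec_of_list [s, t] = vec_of_list [a * s + b * t, c * s + d * t]"
    by (rule eq_vecI)
      (auto simp: vec_of_list_index mat_of_rows_list_def scalar_prod_def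
        numeral_2_eq_2 less_Suc_eq simp del: vec_of_list_Cons)
  have smult: "z \<cdot>\<^sub>v vec_of_list [s, t] = vec_of_list [z * s, z * t]"
    by (rule eq_vecI) (auto simp: vec_of_list_index less_Suc_eq simp del: vec_of_list_Cons)
  show ?thesis
    unfolding eigenvector_def dim zero mult smult inj using carrier by blast
qed

lemma vec_2_eq_vec_of_list:
  assumes "v \<in> carrier_vec 2"
  shows "v = vec_of_list [v $ 0, v $ 1]"
  using assms by (intro eq_vecI) (auto simp: vec_of_list_index less_Suc_eq simp del: vec_of_list_Cons)

text \<open>The eigenvalues are \<open>c * x + d\<close>, with eigenvector (x, 1), and
  \<open>a - c * x\<close>. The first dominates in modulus, since their sum is \<open>a + d\<close>
  and their difference is positive.\<close>

lemma spectral_radius_2: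
  fixes a b c d x :: real
  assumes "b > 0" "c > 0" "a \<ge> 0" "d \<ge> 0" and x: "x > 0" and root: "c * x\<^sup>2 + (d - a) * x - b = 0"
  shows "spectral_radius (map_mat complex_of_real (mat_of_rows_list 2 [[a, b], [c, d]])) = c * x + d"
proof -
  define M where "M = map_mat complex_of_real (mat_of_rows_list 2 [[a, b], [c, d]])"
  have M: "M = mat_of_rows_list 2 [[complex_of_real a, complex_of_real b],
      [complex_of_real c, complex_of_real d]]"
    unfolding M_def by (rule map_mat_of_rows_list_2)
  have carrier: "M \<in> carrier_mat 2 2"
    by (simp add: M mat_of_rows_list_def numeral_2_eq_2)
  have b_eq: "b = x * (c * x + d - a)"
    using root by (simp add: algebra_simps power2_eq_square)
  have "c * x + d - a > 0"
    using \<open>b > 0\<close> x unfolding b_eq by (simp add: zero_less_mult_iff)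
  moreover have "c * x > 0"
    using x \<open>c > 0\<close> by simp
  ultimately have abs_le: "\<bar>a - c * x\<bar> \<le> c * x + d"
    using assms by linarith
  have "eigenvector M (vec_of_list [complex_of_real x, 1]) (complex_of_real (c * x + d))"
    unfolding M eigenvector_2_iff b_eq by (simp add: algebra_simps)
  then have "complex_of_real (c * x + d) \<in> spectrum M"
    by (auto simp: spectrum_def eigenvalue_def)
  then have "norm (complex_of_real (c * x + d)) \<in> norm ` spectrum M"
    by blast
  from spectral_radius_mem_max(2)[OF carrier _ this]
  have lower: "c * x + d \<le> spectral_radius M"
    unfolding norm_of_real by simp
  obtain z where z: "z \<in> spectrum M" "spectral_radius M = norm z"
    using spectral_radius_mem_max(1)[OF carrier] by auto
  then obtain v where v: "eigenvector M v z"
    by (auto simp: spectrum_def eigenvalue_def)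
  then have "v \<in> carrier_vec 2"
    using carrier by (auto simp: eigenvector_def)
  define s t where "s = v $ 0" and "t = v $ 1"
  have "eigenvector M (vec_of_list [s, t]) z"
    using v vec_2_eq_vec_of_list[OF \<open>v \<in> carrier_vec 2\<close>] by (simp add: s_def t_def)
  then have st: "s \<noteq> 0 \<or> t \<noteq> 0"
    and 1: "of_real a * s + of_real b * t = z * s" and 2: "of_real c * s + of_real d * t = z * t"
    unfolding M eigenvector_2_iff by auto
  have b_eq': "complex_of_real b = of_real x * (of_real c * of_real x + of_real d - of_real a)"
    unfolding b_eq by simp
  have char: "(z - of_real (c * x + d)) * (z - of_real (a - c * x)) =
      (z - of_real a) * (z - of_real d) - of_real b * of_real c"
    unfolding b_eq' by (simp add: algebra_simps)
  \<comment> \<open>Eliminating one coordinate from the two eigenvector equations shows that the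
    characteristic polynomial at \<open>z\<close> annihilates the other; since \<open>s\<close> or
    \<open>t\<close> is nonzero, \<open>z\<close> is a root.\<close>
  have "((z - of_real a) * (z - of_real d) - of_real b * of_real c) * s =
      (z - of_real d) * (z * s - of_real a * s) - of_real b * (of_real c * s)"
    by (simp add: algebra_simps)
  also have "\<dots> = of_real b * (z * t - (of_real c * s + of_real d * t))"
    unfolding 1[symmetric] by (simp add: algebra_simps)
  finally have "((z - of_real a) * (z - of_real d) - of_real b * of_real c) * s = 0"
    unfolding 2 by simp
  moreover have "((z - of_real a) * (z - of_real d) - of_real b * of_real c) * t =
      (z - of_real a) * (z * t - of_real d * t) - of_real c * (of_real b * t)"
    by (simp add: algebra_simps)
  then have "((z - of_real a) * (z - of_real d) - of_real b * of_real c) * t =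
      of_real c * (z * s - (of_real a * s + of_real b * t))"
    unfolding 2[symmetric] by (simp add: algebra_simps)
  then have "((z - of_real a) * (z - of_real d) - of_real b * of_real c) * t = 0"
    unfolding 1 by simp
  ultimately have "(z - of_real a) * (z - of_real d) - of_real b * of_real c = 0"
    using st by auto
  then have "z = of_real (c * x + d) \<or> z = of_real (a - c * x)"
    unfolding char[symmetric] by auto
  then have "norm z = \<bar>c * x + d\<bar> \<or> norm z = \<bar>a - c * x\<bar>"
    by (metis norm_of_real)
  then have "norm z \<le> c * x + d"
    using abs_le by linarith
  then show ?thesis
    using lower z(2) unfolding M_def by simp
qed

text \<open>With x = s/t, the second row forces the eigenvalue to be \<open>c * x + d\<close>, and
  the first row then becomes the quadratic. Conversely, a positive root makes
  \<open>c * x + d\<close> the spectral radius.\<close>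

lemma right_PF_eigenvector_2_iff:
  fixes a b c d s t :: real
  assumes "b > 0" "c > 0" "a \<ge> 0" "d \<ge> 0" "s > 0" "t > 0"
  shows "right_PF_eigenvector (mat_of_rows_list 2 [[a, b], [c, d]]) (vec_of_list [s, t]) \<longleftrightarrow>
     c * (s / t)\<^sup>2 + (d - a) * (s / t) - b = 0"
proof -
  have pos: "\<forall>i<dim_vec (vec_of_list [s, t]). vec_of_list [s, t] $ i > 0"
    using assms by (auto simp: less_Suc_eq vec_of_list_index)
  define x where "x = s / t"
  have s: "s = x * t" and "x > 0"
    using assms by (simp_all add: x_def)
  show ?thesis
    unfolding right_PF_eigenvector_def eigenvector_2_iff x_def[symmetric]
  proof (intro iffI)
    let ?l = "spectral_radius (map_mat complex_of_real (mat_of_rows_list 2 [[a, b], [c, d]]))"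
    assume *: "((s \<noteq> 0 \<or> t \<noteq> 0) \<and> a * s + b * t = ?l * s \<and> c * s + d * t = ?l * t) \<and>
      (\<forall>i<dim_vec (vec_of_list [s, t]). vec_of_list [s, t] $ i > 0)"
    then have "(a * x + b - ?l * x) * t = 0" "(c * x + d - ?l) * t = 0"
      unfolding s by (simp_all add: algebra_simps)
    then have "a * x + b = ?l * x" "c * x + d = ?l"
      using \<open>t > 0\<close> by auto
    then have "b = (c * x + d) * x - a * x"
      by simp
    then show "c * x\<^sup>2 + (d - a) * x - b = 0"
      by (simp add: algebra_simps power2_eq_square)
  next
    assume root: "c * x\<^sup>2 + (d - a) * x - b = 0"
    have "a * s + b * t = (c * x + d) * s" "c * s + d * t = (c * x + d) * t"
    proof -
      have b_eq: "b = x * (c * x + d - a)"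
        using root by (simp add: algebra_simps power2_eq_square)
      show "a * s + b * t = (c * x + d) * s" "c * s + d * t = (c * x + d) * t"
        unfolding s b_eq by (simp_all add: algebra_simps)
    qed
    then show "((s \<noteq> 0 \<or> t \<noteq> 0) \<and>
        a * s + b * t = spectral_radius (map_mat complex_of_real (mat_of_rows_list 2 [[a, b], [c, d]])) * s \<and>
        c * s + d * t = spectral_radius (map_mat complex_of_real (mat_of_rows_list 2 [[a, b], [c, d]])) * t) \<and>
      (\<forall>i<dim_vec (vec_of_list [s, t]). vec_of_list [s, t] $ i > 0)"
      using spectral_radius_2[OF assms(1-4) \<open>x > 0\<close> root] pos assms by simp
  qed
qed

section \<open>The positive root of the slope quadratic and the limit criterion\<close>

lemma quadratic_pos_root_exists:
  fixes b c p :: real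
  assumes "b > 0" "c > 0"
  shows "\<exists>x>0. c * x\<^sup>2 + p * x - b = 0"
proof -
  define r where "r = sqrt (p\<^sup>2 + 4 * b * c)"
  have r2: "r\<^sup>2 = p\<^sup>2 + 4 * b * c"
    unfolding r_def using assms by simp
  \<comment> \<open>Since \<open>4 * b * c\<close> is positive, the larger root (r - p)/(2c) is
    positive whatever the sign of \<open>p\<close>.\<close>
  have "\<bar>p\<bar> < r"
    unfolding r_def using assms by (intro real_less_rsqrt) simp
  then have "(r - p) / (2 * c) > 0"
    using assms by simp
  moreover have "c * ((r - p) / (2 * c))\<^sup>2 + p * ((r - p) / (2 * c)) - b = 0"
    using assms r2 by (simp add: field_simps power2_eq_square)
  ultimately show ?thesis by blast
qed

text \<open>Two distinct roots would have the negative product -b/c. The proof cancels the linear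
  terms of the two equations, which leaves the factor x - y.\<close>

lemma quadratic_pos_root_unique:
  fixes b c p x y :: real
  assumes "b > 0" "c > 0" "x > 0" "y > 0" "c * x\<^sup>2 + p * x - b = 0" "c * y\<^sup>2 + p * y - b = 0"
  shows "x = y"
proof -
  have "(x - y) * (c * x * y + b) = 0"
  proof -
    have "(x - y) * (c * x * y + b) = y * (c * x\<^sup>2 + p * x - b) - x * (c * y\<^sup>2 + p * y - b)"
      by (simp add: algebra_simps power2_eq_square)
    then show ?thesis using assms(5,6) by simp
  qed
  moreover have "c * x * y + b > 0"
    using assms by (simp add: add_pos_pos)
  ultimately show ?thesis by simp
qed

text \<open>The limit is x - 1/x for the slope x of the Perron-Frobenius eigenvector, and this
  expression is injective on positive reals, so the limit determines the slope. Choosing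
  \<open>s\<close> and \<open>t\<close> serves all three parts of the theorem.\<close>

lemma pos_diff_limit_iff_right_PF_eigenvector:
  assumes prim: "primitive_substitution \<rho>" and w: "w \<in> words_W" and fixp: "subst_stream \<rho> w = w"
    and "s > 0" "t > 0"
  shows "((\<lambda>n. real_of_int (pos_diff w n) / real n) \<longlonglongrightarrow> s / t - t / s) \<longleftrightarrow>
    right_PF_eigenvector (map_mat real (subst_matrix \<rho>)) (vec_of_list [s, t])"
proof -
  define a b c d where "a = real (count_list (\<rho> LA) LA)" and "b = real (count_list (\<rho> LB) LA)"
    and "c = real (count_list (\<rho> LA) LB)" and "d = real (count_list (\<rho> LB) LB)"
  note abcd = this
  have pos: "b > 0" "c > 0" "a \<ge> 0" "d \<ge> 0"
    using primitive_substitution_counts[OF prim] by (simp_all add: abcd)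
  obtain x where x: "x > 0" "c * x\<^sup>2 + (d - a) * x - b = 0"
    using quadratic_pos_root_exists[OF pos(1,2)] by blast
  have lim: "(\<lambda>n. real_of_int (pos_diff w n) / real n) \<longlonglongrightarrow> x - 1 / x"
    using pos_diff_asymptotics[OF prim w fixp x(1) x(2)[unfolded abcd]] .
  define y where "y = s / t"
  have y: "y > 0" "s / t - t / s = y - 1 / y"
    using assms by (simp_all add: y_def)
  have "((\<lambda>n. real_of_int (pos_diff w n) / real n) \<longlonglongrightarrow> s / t - t / s) \<longleftrightarrow> x - 1 / x = y - 1 / y"
    unfolding y(2) using lim LIMSEQ_unique[OF lim] by metis
  also have "\<dots> \<longleftrightarrow> x = y"
  proof
    assume "x - 1 / x = y - 1 / y"
    \<comment> \<open>The difference of the two sides, multiplied by x y, factors in this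
      way.\<close>
    then have "(x - y) * (x * y + 1) = 0"
      using x y by (simp add: field_simps)
    then show "x = y"
      using x y by (smt (verit) mult_eq_0_iff mult_pos_pos)
  qed simp
  also have "\<dots> \<longleftrightarrow> c * y\<^sup>2 + (d - a) * y - b = 0"
    using x y pos quadratic_pos_root_unique by metis
  also have "\<dots> \<longleftrightarrow> right_PF_eigenvector (map_mat real (subst_matrix \<rho>)) (vec_of_list [s, t])"
    unfolding subst_matrix_eq map_mat_of_rows_list_2 y_def abcd[symmetric]
    using right_PF_eigenvector_2_iff[OF pos assms(4,5)] by simp
  finally show ?thesis .
qed

section \<open>Metallic means\<close>

lemma metallic_mean_pos: "metallic_mean k > 0"
  unfolding metallic_mean_def by (simp add: add_nonneg_pos)

lemma metallic_mean_square: "(metallic_mean k)\<^sup>2 = real k * metallic_mean k + 1"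
  unfolding metallic_mean_def by (simp add: field_simps power2_eq_square)

lemma metallic_mean_minus_inverse: "metallic_mean k - 1 / metallic_mean k = real k"
  using metallic_mean_square[of k] metallic_mean_pos[of k]
  by (simp add: field_simps power2_eq_square)

text \<open>This is the irrationality of the metallic mean: otherwise k^2 + 4 would be the square of
  an integer strictly between k and k + 2, and (k + 1)^2 = k^2 + 4 fails by parity.\<close>

lemma metallic_mean_int_independent:
  fixes p q :: int
  assumes "k \<ge> 1" and eq: "of_int p * metallic_mean k + of_int q = 0"
  shows "p = 0 \<and> q = 0"
proof -
  have "p = 0"
  proof (rule ccontr)
    assume "p \<noteq> 0"
    define r where "r = sqrt ((real k)\<^sup>2 + 4)"
    \<comment> \<open>Doubling clears the denominator of the metallic mean; squaring then removes
      the root and leaves an equation between integers.\<close>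
    have "of_int (2 * q + int k * p) = - (of_int p * r)"
      using eq unfolding metallic_mean_def r_def by (simp add: field_simps)
    then have "(of_int (2 * q + int k * p))\<^sup>2 = (of_int p)\<^sup>2 * r\<^sup>2"
      by (simp only: power2_minus power_mult_distrib)
    then have "real_of_int ((2 * q + int k * p)\<^sup>2) = real_of_int (p\<^sup>2 * ((int k)\<^sup>2 + 4))"
      by (simp add: r_def)
    then have sq: "(2 * q + int k * p)\<^sup>2 = p\<^sup>2 * ((int k)\<^sup>2 + 4)"
      by (simp only: of_int_eq_iff)
    then have "p\<^sup>2 dvd (2 * q + int k * p)\<^sup>2"
      by simp
    then have "p dvd 2 * q + int k * p"
      by simp
    then obtain h where h: "2 * q + int k * p = p * h"
      by (rule dvdE)
    have "\<bar>h\<bar>\<^sup>2 = (int k)\<^sup>2 + 4"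
      using sq \<open>p \<noteq> 0\<close> unfolding h by (simp add: power_mult_distrib)
    moreover have "\<bar>h\<bar> > int k"
      using calculation by (intro power2_less_imp_less[of "int k" "\<bar>h\<bar>"]) auto
    \<comment> \<open>For k \<ge> 1, (k + 2)^2 = k^2 + 4 k + 4 exceeds k^2 + 4.\<close>
    moreover have "\<bar>h\<bar> < int k + 2"
      using calculation(1) \<open>k \<ge> 1\<close>
      by (intro power2_less_imp_less[of "\<bar>h\<bar>" "int k + 2"]) (auto simp: power2_eq_square algebra_simps)
    ultimately have "(int k + 1)\<^sup>2 = (int k)\<^sup>2 + 4"
      by (smt (verit))
    then have "2 * int k = 3"
      by (simp add: power2_eq_square algebra_simps)
    then show False by presburger
  qed
  then show ?thesis
    using eq by simp
qed

section \<open>The three equivalences, read off from the slope quadratic\<close>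

theorem theorem5p4:
  fixes \<rho> :: "letter \<Rightarrow> letter list" and w :: "letter stream" and k :: nat
  assumes "primitive_substitution \<rho>"
    and "w \<in> words_W"
    and "subst_stream \<rho> w = w"
    and "k \<ge> 1"
  shows
    "((((\<lambda>n. real_of_int (pos_diff w n) / real n) \<longlonglongrightarrow> real k) \<longleftrightarrow>
        right_PF_eigenvector (map_mat real (subst_matrix \<rho>)) (vec_of_list [metallic_mean k, 1])) \<and>
     (right_PF_eigenvector (map_mat real (subst_matrix \<rho>)) (vec_of_list [metallic_mean k, 1]) \<longleftrightarrow>
        (\<exists>m n :: nat. m \<ge> 1 \<and> subst_matrix \<rho> = mat_of_rows_list 2 [[k * m + n, m], [m, n]]))) \<and>
     ((((\<lambda>n. real_of_int (pos_diff w n) / real n) \<longlonglongrightarrow> - real k) \<longleftrightarrow>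
        right_PF_eigenvector (map_mat real (subst_matrix \<rho>)) (vec_of_list [1, metallic_mean k])) \<and>
     (right_PF_eigenvector (map_mat real (subst_matrix \<rho>)) (vec_of_list [1, metallic_mean k]) \<longleftrightarrow>
        (\<exists>m n :: nat. m \<ge> 1 \<and> subst_matrix \<rho> = mat_of_rows_list 2 [[n, m], [m, k * m + n]]))) \<and>
     ((((\<lambda>n. real_of_int (pos_diff w n) / real n) \<longlonglongrightarrow> 0) \<longleftrightarrow>
        right_PF_eigenvector (map_mat real (subst_matrix \<rho>)) (vec_of_list [1, 1])) \<and>
     (right_PF_eigenvector (map_mat real (subst_matrix \<rho>)) (vec_of_list [1, 1]) \<longleftrightarrow>
        (\<exists>a b c d :: nat. subst_matrix \<rho> = mat_of_rows_list 2 [[a, b], [c, d]] \<and> a + b = c + d)))"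
proof -
  define \<tau> where "\<tau> = metallic_mean k"
  have \<tau>: "\<tau> > 0" "\<tau>\<^sup>2 = real k * \<tau> + 1" "\<tau> - 1 / \<tau> = real k"
    using metallic_mean_pos metallic_mean_square metallic_mean_minus_inverse by (simp_all add: \<tau>_def)
  have indep: "p = 0 \<and> q = 0" if "of_int p * \<tau> + of_int q = 0" for p q
    using metallic_mean_int_independent[OF assms(4)] that by (simp add: \<tau>_def)
  note lim = pos_diff_limit_iff_right_PF_eigenvector[OF assms(1-3)]
  define a b c d where "a = count_list (\<rho> LA) LA" and "b = count_list (\<rho> LB) LA"
    and "c = count_list (\<rho> LA) LB" and "d = count_list (\<rho> LB) LB"
  note abcd = this
  have pos: "b > 0" "c > 0"
    using primitive_substitution_counts[OF assms(1)] by (simp_all add: abcd)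
  have M: "subst_matrix \<rho> = mat_of_rows_list 2 [[a, b], [c, d]]"
    by (simp add: subst_matrix_eq abcd)
  have PF: "right_PF_eigenvector (map_mat real (subst_matrix \<rho>)) (vec_of_list [s, t]) \<longleftrightarrow>
      real c * (s / t)\<^sup>2 + (real d - real a) * (s / t) - real b = 0" if "s > 0" "t > 0" for s t
    unfolding M map_mat_of_rows_list_2 using that pos by (intro right_PF_eigenvector_2_iff) auto
  \<comment> \<open>Replacing \<open>\<tau>\<^sup>2\<close> by k \<tau> + 1 makes the quadratic an
    integer linear relation between \<tau> and 1.\<close>
  have "right_PF_eigenvector (map_mat real (subst_matrix \<rho>)) (vec_of_list [\<tau>, 1]) \<longleftrightarrow>
      of_int (int (k * c + d) - int a) * \<tau> + of_int (int c - int b) = 0"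
    using PF[of \<tau> 1] \<tau> by (simp add: algebra_simps)
  \<comment> \<open>By irrationality both integer coefficients vanish; the matrix then has the
    required shape with m = c and n = d.\<close>
  also have "\<dots> \<longleftrightarrow> b = c \<and> a = k * c + d"
    using indep[of "int (k * c + d) - int a" "int c - int b"] by (auto simp flip: of_nat_mult of_nat_add)
  also have "\<dots> \<longleftrightarrow> (\<exists>m n. m \<ge> 1 \<and> subst_matrix \<rho> = mat_of_rows_list 2 [[k * m + n, m], [m, n]])"
    using pos unfolding M mat_of_rows_list_2_eq_iff by auto
  finally have 1: "right_PF_eigenvector (map_mat real (subst_matrix \<rho>)) (vec_of_list [\<tau>, 1]) \<longleftrightarrow>
      (\<exists>m n. m \<ge> 1 \<and> subst_matrix \<rho> = mat_of_rows_list 2 [[k * m + n, m], [m, n]])" .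
  have "right_PF_eigenvector (map_mat real (subst_matrix \<rho>)) (vec_of_list [1, \<tau>]) \<longleftrightarrow>
      real c * (1 / \<tau>)\<^sup>2 + (real d - real a) * (1 / \<tau>) - real b = 0"
    using PF[of 1 \<tau>] \<tau>(1) by simp
  \<comment> \<open>The slope is now 1/\<tau>; multiplying by \<open>\<tau>\<^sup>2\<close> prepares
    the same reduction to a linear relation.\<close>
  also have "\<dots> \<longleftrightarrow> real c + (real d - real a) * \<tau> - real b * \<tau>\<^sup>2 = 0"
    using \<tau>(1) by (simp add: field_simps power2_eq_square)
  also have "\<dots> \<longleftrightarrow> of_int (int d - int (k * b + a)) * \<tau> + of_int (int c - int b) = 0"
    unfolding \<tau>(2) by (simp add: algebra_simps)
  finally have "right_PF_eigenvector (map_mat real (subst_matrix \<rho>)) (vec_of_list [1, \<tau>]) \<longleftrightarrow>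
      of_int (int d - int (k * b + a)) * \<tau> + of_int (int c - int b) = 0" .
  also have "\<dots> \<longleftrightarrow> c = b \<and> d = k * b + a"
    using indep[of "int d - int (k * b + a)" "int c - int b"] by (auto simp flip: of_nat_mult of_nat_add)
  also have "\<dots> \<longleftrightarrow> (\<exists>m n. m \<ge> 1 \<and> subst_matrix \<rho> = mat_of_rows_list 2 [[n, m], [m, k * m + n]])"
    using pos unfolding M mat_of_rows_list_2_eq_iff by auto
  finally have 2: "right_PF_eigenvector (map_mat real (subst_matrix \<rho>)) (vec_of_list [1, \<tau>]) \<longleftrightarrow>
      (\<exists>m n. m \<ge> 1 \<and> subst_matrix \<rho> = mat_of_rows_list 2 [[n, m], [m, k * m + n]])" .
  have "right_PF_eigenvector (map_mat real (subst_matrix \<rho>)) (vec_of_list [1, 1]) \<longleftrightarrow>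
      real (a + b) = real (c + d)"
    using PF[of 1 1] by auto
  also have "\<dots> \<longleftrightarrow> (\<exists>a b c d. subst_matrix \<rho> = mat_of_rows_list 2 [[a, b], [c, d]] \<and> a + b = c + d)"
    unfolding M mat_of_rows_list_2_eq_iff of_nat_eq_iff by metis
  finally have 3: "right_PF_eigenvector (map_mat real (subst_matrix \<rho>)) (vec_of_list [1, 1]) \<longleftrightarrow>
      (\<exists>a b c d. subst_matrix \<rho> = mat_of_rows_list 2 [[a, b], [c, d]] \<and> a + b = c + d)" .
  \<comment> \<open>These are the values of s/t - t/s for the three candidate eigenvectors, matching
    the three prescribed limits.\<close>
  have vals: "\<tau> / 1 - 1 / \<tau> = real k" "1 / \<tau> - \<tau> / 1 = - real k" "1 / 1 - 1 / 1 = (0 :: real)"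
    using \<tau>(3) by simp_all
  have one: "(0 :: real) < 1"
    by simp
  show ?thesis
    unfolding \<tau>_def[symmetric]
    using lim[of \<tau> 1, unfolded vals, OF \<tau>(1) one]
      lim[of 1 \<tau>, unfolded vals, OF one \<tau>(1)]
      lim[of 1 1, unfolded vals, OF one one] 1 2 3
    by (intro conjI)
qed

end
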